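(* Let $r,r'$ be positive integers with $1\le r'\le r$. Then for every positive integer $t$, writing $D=4r'(2r-(r'-1))t-(2r+1)$, $$\frac{4}{D}=\frac{1}{r'(2r-(r'-1))t}+\frac{1}{r't\,D}+\frac{1}{(2r-(r'-1))t\,D}.$$
   Context: The identity is between rational numbers. *)

theory Defs
  imports Complex_Main
begin

end

theory Submission
  imports Defs
begin

text \<open>
  Put \<open>s = 2 r - (r' - 1)\<close>. The choice of \<open>s\<close> makes \<open>r' + s = 2 r + 1\<close>, so the definition of \<open>D\<close>
  says \<open>D + s + r' = 4 r' s t\<close>. Dividing this by \<open>r' s t D\<close> gives the decomposition
  (lemma \<open>four_over_eq_sum_of_three_unit_fractions\<close>). What remains is that \<open>D\<close> does not vanish,
  which holds because the product of two positive integers nearly dominates their sum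
  (lemma \<open>sum_less_four_mult\<close>).
\<close>

lemma four_over_eq_sum_of_three_unit_fractions:
  fixes a b t d :: "'a :: field"
  assumes "a \<noteq> 0" and "b \<noteq> 0" and "t \<noteq> 0" and "d \<noteq> 0"
    and sum: "d + b + a = 4 * a * b * t"
  shows "4 / d = 1 / (a * b * t) + 1 / (a * t * d) + 1 / (b * t * d)"
proof -
  have "1 / (a * b * t) + 1 / (a * t * d) + 1 / (b * t * d) = (d + b + a) / (a * b * t * d)"
    using assms(1-4) by (simp add: field_simps)
  also have "\<dots> = 4 / d"
    unfolding sum using assms(1-4) by simp
  finally show ?thesis by simp
qed

text \<open>
  Expanding \<open>(a - 1) (b - 1) \<ge> 0\<close> yields \<open>a + b \<le> a b + 1\<close>, and \<open>a b + 1 < 4 a b\<close> since \<open>a b \<ge> 1\<close>;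
  the factor \<open>t \<ge> 1\<close> only enlarges the right-hand side.
\<close>

lemma sum_less_four_mult:
  fixes a b t :: int
  assumes "1 \<le> a" and "1 \<le> b" and "1 \<le> t"
  shows "a + b < 4 * a * b * t"
proof -
  have "0 \<le> (a - 1) * (b - 1)" using assms by simp
  then have "a + b \<le> a * b + 1" by (simp add: algebra_simps)
  moreover have "1 \<le> a * b" using mult_mono[of 1 a 1 b] assms by simp
  moreover from this have "a * b \<le> a * b * t"
    using mult_left_mono[of 1 t "a * b"] assms by simp
  ultimately show ?thesis by (simp add: mult.assoc)
qed

theorem corollary5p23:
  fixes r r' t D :: int
  assumes "0 < r" and "1 \<le> r'" and "r' \<le> r" and "0 < t"
    and "D = 4 * r' * (2 * r - (r' - 1)) * t - (2 * r + 1)"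
  shows "(4 :: rat) / of_int D =
      1 / of_int (r' * (2 * r - (r' - 1)) * t)
    + 1 / of_int (r' * t * D)
    + 1 / of_int ((2 * r - (r' - 1)) * t * D)"
proof -
  define s where "s = 2 * r - (r' - 1)"
  have s: "1 \<le> s" using assms by (simp add: s_def)
  have sum: "D + s + r' = 4 * r' * s * t"
    using assms(5) unfolding s_def by linarith
  have "0 < D" using sum_less_four_mult[of r' s t] sum s assms by linarith
  moreover have "of_int D + of_int s + of_int r' = (4 * of_int r' * of_int s * of_int t :: rat)"
    using arg_cong[OF sum, of "of_int :: int \<Rightarrow> rat"] by simp
  ultimately have "(4 :: rat) / of_int D =
      1 / (of_int r' * of_int s * of_int t)
    + 1 / (of_int r' * of_int t * of_int D)
    + 1 / (of_int s * of_int t * of_int D)"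
    using s assms(2,4) by (intro four_over_eq_sum_of_three_unit_fractions) auto
  then show ?thesis
    unfolding s_def[symmetric] by simp
qed

end
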